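(* Let $\mathfrak{g}=(V,[\,,])$ be a complex filiform Lie algebra of solvability class $d(\mathfrak{g})\ge 3$. Then every CPA-structure $(V,\cdot)$ on $\mathfrak{g}$ is associative, i.e. satisfies $\mathfrak{g}\cdot[\mathfrak{g},\mathfrak{g}]=0$, and the algebra $(V,\cdot)$ is Poisson-admissible.
   Context: A commutative post-Lie algebra structure (CPA-structure) on a Lie algebra $\mathfrak{g}=(V,[\,,])$ is a bilinear product $x\cdot y$ on $V$ such that for all $x,y,z\in V$: $x\cdot y=y\cdot x$; $[x,y]\cdot z=x\cdot(y\cdot z)-y\cdot(x\cdot z)$; $x\cdot[y,z]=[x\cdot y,z]+[y,x\cdot z]$. It is called associative if $\mathfrak{g}\cdot[\mathfrak{g},\mathfrak{g}]=0$. A finite-dimensional Lie algebra $\mathfrak{g}$ is filiform if it is nilpotent of class $\dim(\mathfrak{g})-1$, where with $\mathfrak{g}^0=\mathfrak{g}$, $\mathfrak{g}^i=[\mathfrak{g},\mathfrak{g}^{i-1}]$, the nilpotency class is the smallest $k\ge1$ with $\mathfrak{g}^k=0$. The solvability class $d(\mathfrak{g})$ is the smallest $k\ge 1$ with $\mathfrak{g}^{(k)}=0$, where $\mathfrak{g}^{(0)}=\mathfrak{g}$, $\mathfrak{g}^{(i)}=[\mathfrak{g}^{(i-1)},\mathfrak{g}^{(i-1)}]$. A Poisson algebra is a triple $(V,\circ,[\,,]_P)$ where $(V,\circ)$ is a commutative associative algebra, $(V,[\,,]_P)$ is a Lie algebra, and $[x,y\circ z]_P=[x,y]_P\circ z+y\circ[x,z]_P$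 for all $x,y,z$. An algebra $(V,\cdot)$ (not assumed associative) is Poisson-admissible if $(V,\circ,[\,,]_P)$ with $[x,y]_P=x\cdot y-y\cdot x$ and $x\circ y=\frac12(x\cdot y+y\cdot x)$ is a Poisson algebra. *)

theory Defs
  imports Complex_Main
begin

text \<open>Algebras live on a whole type \<open>'v\<close>, so \<open>UNIV\<close> is the underlying space.\<close>

locale nonassoc_algebra = vector_space scale
  for scale :: "'k::field \<Rightarrow> 'v::ab_group_add \<Rightarrow> 'v" (infixr \<open>*s\<close> 75) +
  fixes mult :: "'v \<Rightarrow> 'v \<Rightarrow> 'v"
  assumes linear_right: "Vector_Spaces.linear scale scale (mult x)"
    and linear_left: "Vector_Spaces.linear scale scale (\<lambda>x. mult x y)"
begin

definition prod_span :: "'v set \<Rightarrow> 'v set \<Rightarrow> 'v set" where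
  "prod_span A B = span {mult x y | x y. x \<in> A \<and> y \<in> B}"

end

locale lie_algebra = nonassoc_algebra scale bracket
  for scale :: "'k::field \<Rightarrow> 'v::ab_group_add \<Rightarrow> 'v" (infixr \<open>*s\<close> 75)
    and bracket :: "'v \<Rightarrow> 'v \<Rightarrow> 'v" +
  assumes bracket_self: "bracket x x = 0"
    and jacobi: "bracket x (bracket y z) + bracket y (bracket z x) + bracket z (bracket x y) = 0"
begin

primrec lower_central :: "nat \<Rightarrow> 'v set" where
  "lower_central 0 = UNIV"
| "lower_central (Suc i) = prod_span UNIV (lower_central i)"

primrec derived :: "nat \<Rightarrow> 'v set" where
  "derived 0 = UNIV"
| "derived (Suc i) = prod_span (derived i) (derived i)"

definition nilpotent :: bool where
  "nilpotent \<longleftrightarrow> (\<exists>k. lower_central k = {0})"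

text \<open>The next two numbers are meaningful only for nilpotent, respectively solvable, algebras;
  in particular the solvability class is meaningful for every nilpotent algebra.\<close>

definition nilpotency_class :: nat where
  "nilpotency_class = (LEAST k. 1 \<le> k \<and> lower_central k = {0})"

definition solvability_class :: nat where
  "solvability_class = (LEAST k. 1 \<le> k \<and> derived k = {0})"

text \<open>The class is compared as \<open>c + 1 = dim\<close>, since subtraction on \<^typ>\<open>nat\<close> truncates.\<close>

definition filiform :: bool where
  "filiform \<longleftrightarrow> (\<exists>B. finite_dimensional_vector_space scale B) \<and>
     nilpotent \<and> nilpotency_class + 1 = dim UNIV"

end

locale cpa_structure = lie_algebra scale bracket + product: nonassoc_algebra scale mult
  for scale :: "'k::field \<Rightarrow> 'v::ab_group_add \<Rightarrow> 'v" (infixr \<open>*s\<close> 75)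
    and bracket :: "'v \<Rightarrow> 'v \<Rightarrow> 'v"
    and mult :: "'v \<Rightarrow> 'v \<Rightarrow> 'v" (infixl \<open>\<cdot>\<close> 70) +
  assumes commute: "x \<cdot> y = y \<cdot> x"
    and bracket_mult: "bracket x y \<cdot> z = x \<cdot> (y \<cdot> z) - y \<cdot> (x \<cdot> z)"
    and mult_bracket: "x \<cdot> bracket y z = bracket (x \<cdot> y) z + bracket y (x \<cdot> z)"
begin

definition associative :: bool where
  "associative \<longleftrightarrow> product.prod_span UNIV (prod_span UNIV UNIV) = {0}"

end

text \<open>The commutative associative algebra underlying a Poisson algebra need not be unital.\<close>

locale poisson_algebra = circ: nonassoc_algebra scale circ + lie: lie_algebra scale bracket
  for scale :: "'k::field \<Rightarrow> 'v::ab_group_add \<Rightarrow> 'v" (infixr \<open>*s\<close> 75)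
    and circ :: "'v \<Rightarrow> 'v \<Rightarrow> 'v" (infixl \<open>\<circ>\<^sub>P\<close> 70)
    and bracket :: "'v \<Rightarrow> 'v \<Rightarrow> 'v" +
  assumes circ_commute: "x \<circ>\<^sub>P y = y \<circ>\<^sub>P x"
    and circ_assoc: "(x \<circ>\<^sub>P y) \<circ>\<^sub>P z = x \<circ>\<^sub>P (y \<circ>\<^sub>P z)"
    and leibniz: "bracket x (y \<circ>\<^sub>P z) = bracket x y \<circ>\<^sub>P z + y \<circ>\<^sub>P bracket x z"

definition poisson_admissible ::
  "('k::field_char_0 \<Rightarrow> 'v::ab_group_add \<Rightarrow> 'v) \<Rightarrow> ('v \<Rightarrow> 'v \<Rightarrow> 'v) \<Rightarrow> bool" where
  "poisson_admissible scale mult \<longleftrightarrow> nonassoc_algebra scale mult \<and>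
     poisson_algebra scale (\<lambda>x y. scale (1 / 2) (mult x y + mult y x))
       (\<lambda>x y. mult x y - mult y x)"

end

theory Submission
  imports Defs
begin

text \<open>Let \<open>D\<^sub>y z = y \<cdot> z - [y, z]\<close>. This derivation of the Lie algebra is self-adjoint for the
  product, \<open>D\<^sub>y x \<cdot> z = x \<cdot> D\<^sub>y z\<close>, and \<open>[D\<^sub>x, D\<^sub>y] w = [x, y] \<cdot> w + [[x, y], w]\<close>. Being a commutator
  of self-adjoint maps, the latter is skew-adjoint; comparing with \<open>D\<close> of \<open>[x, y]\<close> gives
  \<open>[g, g] \<cdot> (g \<cdot> g) = 0\<close> for every CPA-structure in characteristic other than 2.

  Write \<open>g\<^sup>k\<close> for the lower central series of a filiform algebra \<open>g\<close>; an ideal not contained in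
  \<open>g\<^sup>k\<^sup>+\<^sup>1\<close> contains \<open>g\<^sup>k\<close> if \<open>k \<ge> 1\<close>. If \<open>g \<cdot> g\<^sup>1 \<subseteq> g\<^sup>3\<close> then \<open>g \<cdot> g\<^sup>2 = 0\<close>, because
  \<open>x \<cdot> [y, v] = y \<cdot> (x \<cdot> v)\<close> for \<open>v\<close> in \<open>g\<^sup>1\<close>. If \<open>g \<cdot> g \<subseteq> g\<^sup>2\<close>, this yields \<open>g \<cdot> g\<^sup>1 = 0\<close>.
  Otherwise the annihilator of \<open>g\<^sup>1\<close> is an ideal containing \<open>g \<cdot> g\<close>, hence \<open>g\<^sup>1 \<cdot> g\<^sup>1 = 0\<close>; then the
  centralizer of \<open>g\<^sup>1\<close> contains \<open>g \<cdot> g\<^sup>1\<close>, which forces \<open>g \<cdot> g\<^sup>1 \<subseteq> g\<^sup>3\<close> or \<open>[g\<^sup>1, g\<^sup>1] = 0\<close>; and in the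
  first case the centralizer of \<open>g\<^sup>2\<close> contains \<open>g \<cdot> g\<close>, so again \<open>[g\<^sup>1, g\<^sup>1] = 0\<close>.\<close>

section \<open>Bilinear products and their spans\<close>

context nonassoc_algebra
begin

lemma mult_linear_simps:
  shows "mult x (y + z) = mult x y + mult x z" "mult x (y - z) = mult x y - mult x z"
    "mult x (c *s y) = c *s mult x y" "mult x 0 = 0" "mult x (- y) = - mult x y"
    "mult (x + y) z = mult x z + mult y z" "mult (x - y) z = mult x z - mult y z"
    "mult (c *s x) z = c *s mult x z" "mult 0 z = 0" "mult (- x) z = - mult x z"
proof -
  interpret right: Vector_Spaces.linear scale scale "mult x" by (rule linear_right)
  show "mult x (y + z) = mult x y + mult x z" "mult x (y - z) = mult x y - mult x z"
    "mult x (c *s y) = c *s mult x y" "mult x 0 = 0" "mult x (- y) = - mult x y"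
    by (fact right.add right.diff right.scale right.zero right.neg)+
  interpret left: Vector_Spaces.linear scale scale "\<lambda>x. mult x z" by (rule linear_left)
  show "mult (x + y) z = mult x z + mult y z" "mult (x - y) z = mult x z - mult y z"
    "mult (c *s x) z = c *s mult x z" "mult 0 z = 0" "mult (- x) z = - mult x z"
    by (fact left.add left.diff left.scale left.zero left.neg)+
qed

lemma mult_in_prod_span: "x \<in> A \<Longrightarrow> y \<in> B \<Longrightarrow> mult x y \<in> prod_span A B"
  unfolding prod_span_def by (blast intro: span_base)

lemma prod_span_subset:
  assumes "subspace S" and "\<And>x y. x \<in> A \<Longrightarrow> y \<in> B \<Longrightarrow> mult x y \<in> S"
  shows "prod_span A B \<subseteq> S"
  unfolding prod_span_def using assms by (intro span_minimal) auto

lemma prod_span_eq_zero_iff: "prod_span A B = {0} \<longleftrightarrow> (\<forall>x\<in>A. \<forall>y\<in>B. mult x y = 0)"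
proof
  show "prod_span A B = {0} \<Longrightarrow> \<forall>x\<in>A. \<forall>y\<in>B. mult x y = 0"
    using mult_in_prod_span by blast
next
  assume "\<forall>x\<in>A. \<forall>y\<in>B. mult x y = 0"
  then have "prod_span A B \<subseteq> {0}"
    by (intro prod_span_subset) auto
  then show "prod_span A B = {0}"
    using span_zero unfolding prod_span_def by blast
qed

end

section \<open>Filiform Lie algebras\<close>

context lie_algebra
begin

declare lower_central.simps [simp del]

lemma bracket_swap: "bracket x y = - bracket y x"
proof -
  have "bracket (x + y) (x + y) = bracket x y + bracket y x"
    unfolding mult_linear_simps by (simp add: bracket_self)
  then have "bracket x y + bracket y x = 0"
    by (simp only: bracket_self)
  then show ?thesis
    by (simp add: eq_neg_iff_add_eq_0)
qed

lemma bracket_bracket: "bracket x (bracket y z) = bracket (bracket x y) z + bracket y (bracket x z)"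
proof -
  have "bracket y (bracket z x) = - bracket y (bracket x z)"
    by (subst bracket_swap [of z x]) (rule mult_linear_simps(5))
  moreover have "bracket z (bracket x y) = - bracket (bracket x y) z"
    by (rule bracket_swap)
  ultimately show ?thesis
    using jacobi [of x y z] by (simp add: algebra_simps add_eq_0_iff2)
qed

lemma subspace_lower_central: "subspace (lower_central k)"
  by (cases k) (simp_all add: lower_central.simps prod_span_def)

lemma bracket_lower_central:
  assumes "y \<in> lower_central k"
  shows "bracket x y \<in> lower_central (Suc k)" "bracket y x \<in> lower_central (Suc k)"
proof -
  show "bracket x y \<in> lower_central (Suc k)"
    unfolding lower_central.simps using assms by (intro mult_in_prod_span) auto
  then show "bracket y x \<in> lower_central (Suc k)"
    by (subst bracket_swap) (intro subspace_neg subspace_lower_central)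
qed

lemma lower_central_induct [consumes 1, case_names subspace bracket]:
  assumes "v \<in> lower_central (Suc k)"
    and "subspace {v. P v}" and "\<And>x y. y \<in> lower_central k \<Longrightarrow> P (bracket x y)"
  shows "P v"
  using assms prod_span_subset [of "{v. P v}" UNIV "lower_central k"]
  unfolding lower_central.simps by blast

lemma lower_central_Suc_subset: "lower_central (Suc k) \<subseteq> lower_central k"
proof (induction k)
  case 0
  show ?case by (simp add: lower_central.simps)
next
  case (Suc k)
  show ?case
    by (subst lower_central.simps(2), rule prod_span_subset [OF subspace_lower_central])
      (use Suc.IH bracket_lower_central in blast)
qed

lemma lower_central_antimono: "i \<le> j \<Longrightarrow> lower_central j \<subseteq> lower_central i"
  using lift_Suc_antimono_le [of lower_central, OF lower_central_Suc_subset] .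

lemma zero_in_lower_central: "0 \<in> lower_central k"
  by (rule subspace_0 [OF subspace_lower_central])

section \<open>Ideals against the lower central series\<close>

definition lie_ideal :: "'v set \<Rightarrow> bool" where
  "lie_ideal I \<longleftrightarrow> subspace I \<and> (\<forall>x. \<forall>y\<in>I. bracket x y \<in> I)"

lemma lie_ideal_centralizer:
  assumes "\<And>x y. y \<in> S \<Longrightarrow> bracket x y \<in> S"
  shows "lie_ideal {x. \<forall>y\<in>S. bracket x y = 0}"
proof -
  have "bracket (bracket x z) y = 0" if "\<forall>y\<in>S. bracket z y = 0" "y \<in> S" for x y z
    using bracket_bracket [of x z y] that assms by (simp add: mult_linear_simps)
  then show ?thesis
    unfolding lie_ideal_def by (auto simp: subspace_def mult_linear_simps)
qed

text \<open>Approximation by \<open>I\<close> modulo the next term passes to deeper terms by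
  bracketing; nilpotency ends the successive corrections.\<close>

lemma lower_central_subset_ideal:
  assumes "nilpotent" and I: "lie_ideal I"
    and step: "\<And>v. v \<in> lower_central k \<Longrightarrow> \<exists>u\<in>I. v - u \<in> lower_central (Suc k)"
  shows "lower_central k \<subseteq> I"
proof -
  have sub: "subspace I" and brI: "\<And>x y. y \<in> I \<Longrightarrow> bracket x y \<in> I"
    using I unfolding lie_ideal_def by auto
  have *: "\<exists>u\<in>I. v - u \<in> lower_central (Suc m)" if "k \<le> m" "v \<in> lower_central m" for m v
    using that
  proof (induction m arbitrary: v rule: dec_induct)
    case base
    then show ?case by (rule step)
  next
    case (step m)
    let ?L = "lower_central (Suc (Suc m))"
    from step.prems show ?case
    proof (induction rule: lower_central_induct)
      case subspace
      show ?case
      proof (rule subspaceI; clarsimp)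
        show "\<exists>u\<in>I. - u \<in> ?L"
          using subspace_0 [OF sub] zero_in_lower_central by force
      next
        fix x y u w assume "u \<in> I" "x - u \<in> ?L" "w \<in> I" "y - w \<in> ?L"
        then have "u + w \<in> I" "(x + y) - (u + w) \<in> ?L"
          using sub subspace_add [OF subspace_lower_central, of "x - u" _ "y - w"]
          by (auto intro: subspace_add simp: algebra_simps)
        then show "\<exists>u\<in>I. x + y - u \<in> ?L" by blast
      next
        fix c x u assume "u \<in> I" "x - u \<in> ?L"
        then have "c *s u \<in> I" "c *s x - c *s u \<in> ?L"
          using sub subspace_scale [OF subspace_lower_central, of "x - u" _ c]
          by (auto intro: subspace_scale simp: scale_right_diff_distrib)
        then show "\<exists>u\<in>I. c *s x - u \<in> ?L" by blast
      qed
    next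
      case (bracket x y)
      then obtain u where "u \<in> I" "y - u \<in> lower_central (Suc m)"
        using step.IH by blast
      then show ?case
        using brI [of u x] bracket_lower_central(1) [of "y - u" "Suc m" x]
        by (auto simp: mult_linear_simps)
    qed
  qed
  obtain N where N: "lower_central N = {0}"
    using \<open>nilpotent\<close> unfolding nilpotent_def by blast
  \<comment> \<open>Downward induction: the term is zero once \<open>m \<ge> N\<close>, and before
    that the correction \<open>v - u\<close> already lies in \<open>I\<close>.\<close>
  have "lower_central m \<subseteq> I" if "k \<le> m" for m
    using that
  proof (induction "N - m" arbitrary: m)
    case 0
    then have "lower_central m \<subseteq> {0}" using lower_central_antimono [of N m] N by simp
    then show ?case using subspace_0 [OF sub] by auto
  next
    case (Suc d)
    then have "lower_central (Suc m) \<subseteq> I" by simp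
    show ?case
    proof
      fix v assume "v \<in> lower_central m"
      then obtain u where "u \<in> I" "v - u \<in> I"
        using * Suc.prems \<open>lower_central (Suc m) \<subseteq> I\<close> by blast
      then show "v \<in> I" using subspace_add [OF sub, of u "v - u"] by simp
    qed
  qed
  then show ?thesis by simp
qed

section \<open>Dimensions in a filiform algebra\<close>

lemma lower_central_nilpotency_class:
  assumes "nilpotent"
  shows "1 \<le> nilpotency_class" "lower_central nilpotency_class = {0}"
proof -
  obtain k where "lower_central k = {0}"
    using assms unfolding nilpotent_def by blast
  \<comment> \<open>\<open>k\<close> may be 0, so \<open>Suc k\<close> secures the lower bound 1 in
    \<open>nilpotency_class\<close>.\<close>
  then have "1 \<le> Suc k \<and> lower_central (Suc k) = {0}"
    using lower_central_Suc_subset [of k] zero_in_lower_central by auto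
  then have "1 \<le> nilpotency_class \<and> lower_central nilpotency_class = {0}"
    unfolding nilpotency_class_def by (rule LeastI)
  then show "1 \<le> nilpotency_class" "lower_central nilpotency_class = {0}" by auto
qed

lemma lower_central_stationary:
  assumes "nilpotent" and "lower_central (Suc k) = lower_central k"
  shows "lower_central k = {0}"
proof -
  have "lower_central (k + j) = lower_central k" for j
    by (induction j) (use assms(2) in \<open>simp_all add: lower_central.simps\<close>)
  moreover obtain N where "lower_central N = {0}"
    using \<open>nilpotent\<close> unfolding nilpotent_def by blast
  then have "lower_central (k + N) \<subseteq> {0}"
    using lower_central_antimono [of N "k + N"] by simp
  ultimately show ?thesis
    using zero_in_lower_central by auto
qed

text \<open>Modulo \<open>lower_central 2\<close> the bracket sees only classes modulo
  \<open>lower_central 1\<close>; being alternating, it yields the determinant of the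
  coordinates.\<close>

lemma bracket_mod_lower_central_2:
  assumes "u - a *s x - b *s y \<in> lower_central 1" "v - c *s x - d *s y \<in> lower_central 1"
  shows "bracket u v - (a * d - b * c) *s bracket x y \<in> lower_central 2"
proof -
  define p q where "p = u - a *s x - b *s y" and "q = v - c *s x - d *s y"
  have u: "u = a *s x + b *s y + p" and v: "v = c *s x + d *s y + q"
    by (simp_all add: p_def q_def)
  have "bracket u v - (a * d - b * c) *s bracket x y
      = bracket p v + bracket (a *s x + b *s y) q"
    unfolding u v by (simp add: mult_linear_simps bracket_self bracket_swap [of y x]
        algebra_simps scale_left_diff_distrib)
  moreover have "bracket p v \<in> lower_central 2" "bracket (a *s x + b *s y) q \<in> lower_central 2"
    using assms bracket_lower_central [of _ 1] unfolding p_def q_def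
    by (simp_all add: numeral_2_eq_2)
  ultimately show ?thesis
    by (simp add: subspace_add [OF subspace_lower_central])
qed

text \<open>The inclusions from \<open>UNIV\<close> down to \<open>{0}\<close> are strict,
  \<open>nilpotency_class\<close> in number, and share the dimension
  \<open>nilpotency_class + 1\<close>. The first costs at least two, hence exactly two, and every
  other one.\<close>

lemma dim_lower_central:
  assumes "filiform" and "1 \<le> k" "k \<le> nilpotency_class"
  shows "dim (lower_central k) + k = nilpotency_class"
proof -
  obtain B where B: "finite_dimensional_vector_space scale B"
    and nil: "nilpotent" and dimU: "nilpotency_class + 1 = dim UNIV"
    using assms unfolding filiform_def by blast
  interpret fd: finite_dimensional_vector_space scale B by (rule B)
  let ?c = nilpotency_class
  have c: "1 \<le> ?c" "lower_central ?c = {0}"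
    using lower_central_nilpotency_class [OF nil] by auto
  have strict: "dim (lower_central (Suc j)) < dim (lower_central j)" if "j < ?c" for j
  proof -
    have "lower_central (Suc j) \<noteq> lower_central j"
    proof
      assume "lower_central (Suc j) = lower_central j"
      then have zero: "lower_central j = {0}"
        using lower_central_stationary nil by blast
      \<comment> \<open>The minimum defining \<open>nilpotency_class\<close> ranges over
        \<open>k \<ge> 1\<close>, so \<open>j = 0\<close> is excluded by dimension instead.\<close>
      show False
      proof (cases j)
        case 0
        then have "dim UNIV = dim {0}" using zero by (simp add: lower_central.simps(1))
        also have "dim {0} = 0" using fd.dim_insert [of 0 "{}"] by simp
        finally show False using dimU by simp
      next
        case Suc
        then have "1 \<le> j \<and> lower_central j = {0}" using zero by simp
        then show False
          using not_less_Least [of j] \<open>j < ?c\<close> unfolding nilpotency_class_def by blast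
      qed
    qed
    then have "lower_central (Suc j) \<subset> lower_central j"
      using lower_central_Suc_subset by blast
    then show ?thesis
      by (intro fd.dim_psubset) (simp add: span_eq_iff [THEN iffD2, OF subspace_lower_central])
  qed
  have lower: "?c \<le> dim (lower_central j) + j" if "j \<le> ?c" for j
    using that
  proof (induction "?c - j" arbitrary: j)
    case 0
    then show ?case by simp
  next
    case (Suc d)
    then have "?c \<le> dim (lower_central (Suc j)) + Suc j"
      using Suc.hyps(1) [of "Suc j"] by linarith
    then show ?case using strict [of j] Suc by linarith
  qed
  \<comment> \<open>If the abelianization were a line, all commutators would lie in
    \<open>lower_central 2\<close> and the series would be stationary from
    \<open>lower_central 1\<close> on.\<close>
  have "dim (lower_central 1) \<noteq> ?c"
  proof
    assume dim1: "dim (lower_central 1) = ?c"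
    have "lower_central 1 \<noteq> UNIV" using dim1 dimU by auto
    then obtain x where x: "x \<notin> lower_central 1" by blast
    have "dim (insert x (lower_central 1)) = dim UNIV"
      using fd.dim_insert [of x "lower_central 1"] x dim1 dimU
      by (simp add: span_eq_iff [THEN iffD2, OF subspace_lower_central])
    then have UN: "span (insert x (lower_central 1)) = UNIV"
      using fd.dim_eq_span [of "insert x (lower_central 1)" UNIV] by simp
    \<comment> \<open>The dummy generator 0 gives the shape that
      \<open>bracket_mod_lower_central_2\<close> expects.\<close>
    have dec: "\<exists>a. v - a *s x - 0 *s 0 \<in> lower_central 1" for v
      using UN span_breakdown_eq [of v x "lower_central 1"] 
      by (auto simp: span_eq_iff [THEN iffD2, OF subspace_lower_central])
    have "bracket u v \<in> lower_central 2" for u v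
    proof -
      obtain a c where "u - a *s x - 0 *s 0 \<in> lower_central 1" "v - c *s x - 0 *s 0 \<in> lower_central 1"
        using dec by blast
      from bracket_mod_lower_central_2 [OF this] show ?thesis by simp
    qed
    then have "lower_central 1 \<subseteq> lower_central 2"
      unfolding One_nat_def lower_central.simps(2) [of 0]
      by (intro prod_span_subset subspace_lower_central)
    then have "lower_central (Suc 1) = lower_central 1"
      using lower_central_Suc_subset [of 1] by (auto simp: numeral_2_eq_2)
    then have "lower_central 1 = {0}"
      using lower_central_stationary nil by blast
    then show False using dim1 c(1) by simp
  qed
  then have one: "dim (lower_central 1) + 1 \<le> ?c"
    using strict [of 0] dimU c(1) by (simp add: lower_central.simps(1))
  have "dim (lower_central j) + j \<le> ?c" if "1 \<le> j" "j \<le> ?c" for j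
    using that
  proof (induction j rule: dec_induct)
    case base
    show ?case by (rule one)
  next
    case (step j)
    then show ?case using strict [of j] by simp
  qed
  then show ?thesis using lower assms(2,3) by (simp add: le_antisym)
qed

text \<open>The element \<open>w\<close> forces \<open>k < nilpotency_class\<close>, where
  consecutive dimensions differ by one.\<close>

lemma lower_central_one_dim_quotient:
  assumes "filiform" and "1 \<le> k"
    and w: "w \<in> lower_central k" "w \<notin> lower_central (Suc k)" and v: "v \<in> lower_central k"
  obtains c where "v - c *s w \<in> lower_central (Suc k)"
proof -
  obtain B where B: "finite_dimensional_vector_space scale B" and nil: "nilpotent"
    using assms unfolding filiform_def by blast
  interpret fd: finite_dimensional_vector_space scale B by (rule B)
  note span_lc = span_eq_iff [THEN iffD2, OF subspace_lower_central]
  have "k < nilpotency_class"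
  proof (rule ccontr)
    assume "\<not> k < nilpotency_class"
    then have "w = 0"
      using w(1) lower_central_antimono [of nilpotency_class k]
        lower_central_nilpotency_class(2) [OF nil] by auto
    then show False using w(2) zero_in_lower_central by simp
  qed
  then have "dim (lower_central k) = dim (insert w (lower_central (Suc k)))"
    using dim_lower_central [OF assms(1), of k] dim_lower_central [OF assms(1), of "Suc k"]
      \<open>1 \<le> k\<close> w(2) by (simp add: fd.dim_insert span_lc)
  moreover have "insert w (lower_central (Suc k)) \<subseteq> lower_central k"
    using w(1) lower_central_Suc_subset by blast
  ultimately have "span (insert w (lower_central (Suc k))) = lower_central k"
    using fd.dim_eq_span [of "insert w (lower_central (Suc k))" "lower_central k"]
    by (simp add: span_lc)
  then have "\<exists>c. v - c *s w \<in> lower_central (Suc k)"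
    using v span_breakdown_eq [of v w "lower_central (Suc k)"] by (simp add: span_lc)
  then show thesis using that by blast
qed

text \<open>\<open>lower_central 1\<close> has codimension two, so with \<open>w\<close> it spans a
  hyperplane; any \<open>y\<close> outside completes it.\<close>

lemma two_dim_abelianization:
  assumes "filiform" and w: "w \<notin> lower_central 1"
  obtains y where "\<And>v. \<exists>a b. v - a *s w - b *s y \<in> lower_central 1"
proof -
  obtain B where B: "finite_dimensional_vector_space scale B" and nil: "nilpotent"
    and dimU: "nilpotency_class + 1 = dim UNIV"
    using assms unfolding filiform_def by blast
  interpret fd: finite_dimensional_vector_space scale B by (rule B)
  note span_lc = span_eq_iff [THEN iffD2, OF subspace_lower_central]
  let ?S = "insert w (lower_central 1)"
  have dimS: "dim ?S + 1 = dim UNIV"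
    using dim_lower_central [OF assms(1), of 1] lower_central_nilpotency_class(1) [OF nil] w dimU
    by (simp add: fd.dim_insert span_lc)
  then have "span ?S \<noteq> UNIV"
    by (metis dim_span n_not_Suc_n Suc_eq_plus1)
  then obtain y where y: "y \<notin> span ?S" by blast
  then have "dim (insert y ?S) = dim UNIV"
    using dimS by (simp add: fd.dim_insert)
  then have "span (insert y ?S) = UNIV"
    using fd.dim_eq_span [of "insert y ?S" UNIV] by simp
  then have "\<exists>a b. v - a *s w - b *s y \<in> lower_central 1" for v
  proof -
    obtain b where "v - b *s y \<in> span ?S"
      using \<open>span (insert y ?S) = UNIV\<close> span_breakdown_eq [of v y ?S] by blast
    then obtain a where "v - b *s y - a *s w \<in> lower_central 1"
      unfolding span_breakdown_eq span_lc by blast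
    moreover have "v - b *s y - a *s w = v - a *s w - b *s y"
      by (rule diff_right_commute)
    ultimately show ?thesis by metis
  qed
  then show thesis using that by blast
qed

text \<open>From \<open>k = 1\<close> on the quotients are at most lines, so one element of
  \<open>I\<close> outside the next term suffices. An element outside \<open>lower_central 1\<close>
  is first bracketed with a complementary generator.\<close>

lemma lower_central_subset_lie_ideal:
  assumes "filiform" and I: "lie_ideal I" and "1 \<le> k" and "\<not> I \<subseteq> lower_central (Suc k)"
  shows "lower_central k \<subseteq> I"
  using assms(3,4)
proof (induction k rule: dec_induct)
  case base
  have nil: "nilpotent" using assms(1) unfolding filiform_def by blast
  have scaleI: "\<And>c u. u \<in> I \<Longrightarrow> c *s u \<in> I" and brI: "\<And>x u. u \<in> I \<Longrightarrow> bracket x u \<in> I"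
    using I unfolding lie_ideal_def by (auto intro: subspace_scale)
  obtain w where w: "w \<in> I" "w \<notin> lower_central (Suc 1)" using base by blast
  show ?case
  proof (cases "w \<in> lower_central 1")
    case True
    show ?thesis
    proof (rule lower_central_subset_ideal [OF nil I])
      fix v assume "v \<in> lower_central 1"
      then obtain c where "v - c *s w \<in> lower_central (Suc 1)"
        using lower_central_one_dim_quotient [OF assms(1) order_refl True w(2)] by blast
      then show "\<exists>u\<in>I. v - u \<in> lower_central (Suc 1)"
        using w(1) scaleI by blast
    qed
  next
    case False
    obtain y where y: "\<And>v. \<exists>a b. v - a *s w - b *s y \<in> lower_central 1"
      using two_dim_abelianization [OF assms(1) False] by blast
    have wy: "bracket w y \<in> I"
      using brI [OF w(1), of "- y"] by (simp add: bracket_swap [of w] mult_linear_simps)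
    \<comment> \<open>By the determinant formula, \<open>bracket w y\<close> generates
      \<open>lower_central 1\<close> modulo \<open>lower_central 2\<close>.\<close>
    let ?S = "span (insert (bracket w y) (lower_central 2))"
    have "bracket u v \<in> ?S" for u v
    proof -
      obtain a b c d where "u - a *s w - b *s y \<in> lower_central 1"
        "v - c *s w - d *s y \<in> lower_central 1"
        using y by meson
      from bracket_mod_lower_central_2 [OF this] show ?thesis
        unfolding span_breakdown_eq by (blast intro: span_base)
    qed
    then have S: "lower_central 1 \<subseteq> ?S"
      unfolding One_nat_def lower_central.simps(2) [of 0]
      by (intro prod_span_subset subspace_span)
    show ?thesis
    proof (rule lower_central_subset_ideal [OF nil I])
      fix v assume "v \<in> lower_central 1"
      then obtain c where "v - c *s bracket w y \<in> span (lower_central 2)"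
        using S span_breakdown_eq by blast
      then show "\<exists>u\<in>I. v - u \<in> lower_central (Suc 1)"
        using scaleI [OF wy, of c]
        by (auto simp: numeral_2_eq_2 span_eq_iff [THEN iffD2, OF subspace_lower_central])
    qed
  qed
next
  case (step k)
  have nil: "nilpotent" using assms(1) unfolding filiform_def by blast
  obtain w where w: "w \<in> I" "w \<notin> lower_central (Suc (Suc k))" using step.prems by blast
  show ?case
  proof (cases "w \<in> lower_central (Suc k)")
    case True
    show ?thesis
    proof (rule lower_central_subset_ideal [OF nil I])
      fix v assume "v \<in> lower_central (Suc k)"
      then obtain c where "v - c *s w \<in> lower_central (Suc (Suc k))"
        using lower_central_one_dim_quotient [OF assms(1) le_SucI [OF step.hyps(1)] True w(2)]
        by blast
      moreover have "c *s w \<in> I"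
        using I w(1) unfolding lie_ideal_def by (auto intro: subspace_scale)
      ultimately show "\<exists>u\<in>I. v - u \<in> lower_central (Suc (Suc k))" by blast
    qed
  next
    case False
    then show ?thesis using step.IH w(1) lower_central_Suc_subset by blast
  qed
qed

text \<open>Modulo \<open>lower_central 2\<close>, elements of \<open>lower_central 1\<close> are
  proportional, and the bracket is alternating. The contrapositive is how solvability class at least
  3 enters.\<close>

lemma solvability_class_le_2:
  assumes "filiform" and "\<And>x y. x \<in> lower_central 1 \<Longrightarrow> y \<in> lower_central 2 \<Longrightarrow> bracket x y = 0"
  shows "solvability_class \<le> 2"
proof -
  have *: "bracket x y = 0" if x: "x \<in> lower_central 1" and y: "y \<in> lower_central 1" for x y
  proof (cases "x \<in> lower_central 2")
    case True
    show ?thesis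
      by (subst bracket_swap) (simp only: assms(2) [OF y True] minus_zero)
  next
    case False
    obtain c where "y - c *s x \<in> lower_central 2"
      by (rule lower_central_one_dim_quotient [OF assms(1) order_refl x, unfolded Suc_1, OF False y])
    then have "bracket x (y - c *s x) = 0" by (rule assms(2) [OF x])
    then show ?thesis by (simp add: mult_linear_simps bracket_self)
  qed
  have "derived 2 = {0}"
    unfolding numeral_2_eq_2 derived.simps prod_span_eq_zero_iff
    using * by (simp add: lower_central.simps)
  then show ?thesis
    unfolding solvability_class_def by (intro Least_le) simp
qed

end

section \<open>CPA-structures\<close>

context cpa_structure
begin

text \<open>Both sides expand to \<open>x \<cdot> (y \<cdot> z) - y \<cdot> (x \<cdot> z) + z
  \<cdot> (y \<cdot> x)\<close>.\<close>

lemma self_adjoint: "(y \<cdot> x - bracket y x) \<cdot> z = x \<cdot> (y \<cdot> z - bracket y z)"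
proof -
  have "x \<cdot> bracket y z = y \<cdot> (z \<cdot> x) - z \<cdot> (y \<cdot> x)"
    by (subst commute) (rule bracket_mult)
  moreover have "bracket y x \<cdot> z = y \<cdot> (x \<cdot> z) - x \<cdot> (y \<cdot> z)"
    by (rule bracket_mult)
  ultimately show ?thesis
    by (simp add: product.mult_linear_simps commute [of z x] commute [of z "y \<cdot> x"])
qed

text \<open>The mixed commutators contribute
  \<open>bracket (y \<cdot> x) w - bracket (x \<cdot> y) w\<close>, which vanishes by
  commutativity.\<close>

lemma commutator_difference:
  "bracket x y \<cdot> w + bracket (bracket x y) w =
    (x \<cdot> (y \<cdot> w - bracket y w) - bracket x (y \<cdot> w - bracket y w))
    - (y \<cdot> (x \<cdot> w - bracket x w) - bracket y (x \<cdot> w - bracket x w))"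
proof -
  have "bracket (y \<cdot> x) w = bracket (x \<cdot> y) w" by (simp add: commute)
  then show ?thesis
    unfolding product.mult_linear_simps mult_linear_simps bracket_mult mult_bracket
    using bracket_bracket [of x y w] by (simp add: algebra_simps)
qed

lemma commutator_mult_mult:
  assumes two: "(2::'k) \<noteq> 0" and "z \<in> lower_central 1"
  shows "z \<cdot> (u \<cdot> v) = 0"
proof -
  have "bracket x y \<cdot> (v \<cdot> u) = 0" for x y u v
  proof -
    let ?z = "bracket x y"
    define D where "D x w = x \<cdot> w - bracket x w" for x w
    have adj: "D a b \<cdot> c = b \<cdot> D a c" for a b c
      unfolding D_def by (rule self_adjoint)
    have comm: "?z \<cdot> w + bracket ?z w = D x (D y w) - D y (D x w)" for w
      unfolding D_def by (rule commutator_difference)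
    have "(?z \<cdot> u + bracket ?z u) \<cdot> v = - (u \<cdot> (?z \<cdot> v + bracket ?z v))"
      unfolding comm by (simp add: product.mult_linear_simps adj)
    \<comment> \<open>Added to the skew relation, this cancels \<open>bracket ?z u \<cdot> v\<close>
      and \<open>u \<cdot> (?z \<cdot> v)\<close> and doubles the rest.\<close>
    moreover have "(?z \<cdot> u - bracket ?z u) \<cdot> v = u \<cdot> (?z \<cdot> v - bracket ?z v)"
      by (rule self_adjoint)
    moreover have "((?z \<cdot> u) \<cdot> v + u \<cdot> bracket ?z v) + ((?z \<cdot> u) \<cdot> v + u \<cdot> bracket ?z v)
        = ((?z \<cdot> u + bracket ?z u) \<cdot> v + u \<cdot> (?z \<cdot> v + bracket ?z v))
          + ((?z \<cdot> u - bracket ?z u) \<cdot> v - u \<cdot> (?z \<cdot> v - bracket ?z v))"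
      unfolding product.mult_linear_simps by (simp add: algebra_simps)
    ultimately have "((?z \<cdot> u) \<cdot> v + u \<cdot> bracket ?z v) + ((?z \<cdot> u) \<cdot> v + u \<cdot> bracket ?z v) = 0"
      by simp
    then have "2 *s ((?z \<cdot> u) \<cdot> v + u \<cdot> bracket ?z v) = 0"
      using scale_left_distrib [of 1 1] by simp
    then have "(?z \<cdot> u) \<cdot> v + u \<cdot> bracket ?z v = 0"
      using two by simp
    \<comment> \<open>The last term cancels \<open>(?z \<cdot> u) \<cdot> v\<close>, leaving only
      \<open>?z \<cdot> (v \<cdot> u)\<close>.\<close>
    moreover have "u \<cdot> bracket ?z v = ?z \<cdot> (v \<cdot> u) - v \<cdot> (?z \<cdot> u)"
      by (subst commute) (rule bracket_mult)
    ultimately show ?thesis by (simp add: commute [of v "?z \<cdot> u"])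
  qed
  note * = this
  from assms(2) have "z \<in> lower_central (Suc 0)" by simp
  then show ?thesis
    by (induction rule: lower_central_induct)
      (auto simp: subspace_def product.mult_linear_simps *)
qed

section \<open>Products along the lower central series\<close>

lemma subspace_mult_vimage: "subspace S \<Longrightarrow> subspace {v. x \<cdot> v \<in> S}"
  by (auto simp: subspace_def product.mult_linear_simps)

lemma mult_lower_central: "y \<in> lower_central k \<Longrightarrow> x \<cdot> y \<in> lower_central k"
proof (induction k arbitrary: x y)
  case 0
  show ?case by (simp add: lower_central.simps)
next
  case (Suc k)
  from Suc.prems show ?case
  proof (induction rule: lower_central_induct)
    case subspace
    show ?case by (intro subspace_mult_vimage subspace_lower_central)
  next
    case (bracket y z)
    then show ?case
      unfolding mult_bracket using Suc.IH bracket_lower_central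
      by (intro subspace_add [OF subspace_lower_central]) auto
  qed
qed

lemma mult_bracket_lower_central_1:
  assumes "(2::'k) \<noteq> 0" and "v \<in> lower_central 1"
  shows "x \<cdot> bracket y v = y \<cdot> (x \<cdot> v)"
proof -
  have "x \<cdot> bracket y v = y \<cdot> (v \<cdot> x) - v \<cdot> (y \<cdot> x)"
    by (subst commute) (rule bracket_mult)
  then show ?thesis
    by (simp add: commutator_mult_mult [OF assms] commute [of v x])
qed

text \<open>Two evaluations of \<open>b \<cdot> bracket a v\<close> are compared. The formula shows
  that products centralize elements with vanishing products.\<close>

lemma bracket_mult_lower_central_1:
  assumes "(2::'k) \<noteq> 0" and "v \<in> lower_central 1"
  shows "bracket (a \<cdot> b) v = a \<cdot> (b \<cdot> v) - bracket a (b \<cdot> v)"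
  using mult_bracket [of b a v] mult_bracket_lower_central_1 [OF assms, of b a]
  by (simp add: commute [of b a])

text \<open>Multiplication by \<open>x\<close> acts on a quotient that is at most a line, with
  square zero because \<open>x \<cdot> (x \<cdot> v) = x \<cdot> bracket x v\<close>; so it acts as
  zero.\<close>

lemma mult_lower_central_Suc:
  assumes two: "(2::'k) \<noteq> 0" and "filiform" and "1 \<le> k" and v: "v \<in> lower_central k"
  shows "x \<cdot> v \<in> lower_central (Suc k)"
proof (rule ccontr)
  let ?w = "x \<cdot> v"
  assume "?w \<notin> lower_central (Suc k)"
  then obtain c where c: "v - c *s ?w \<in> lower_central (Suc k)"
    using lower_central_one_dim_quotient [OF assms(2,3) mult_lower_central [OF v] _ v] by blast
  have "v \<in> lower_central 1"
    using v lower_central_antimono [OF \<open>1 \<le> k\<close>] by blast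
  then have "x \<cdot> ?w = x \<cdot> bracket x v"
    by (simp add: mult_bracket_lower_central_1 [OF two])
  then have "c *s (x \<cdot> ?w) \<in> lower_central (Suc k)"
    using mult_lower_central [OF bracket_lower_central(1) [OF v]]
    by (simp add: subspace_scale [OF subspace_lower_central])
  moreover have "?w - c *s (x \<cdot> ?w) \<in> lower_central (Suc k)"
    using mult_lower_central [OF c, of x] by (simp add: product.mult_linear_simps)
  ultimately have "?w \<in> lower_central (Suc k)"
    using subspace_add [OF subspace_lower_central] by fastforce
  with \<open>?w \<notin> lower_central (Suc k)\<close> show False ..
qed

lemma mult_lower_central_2_eq_0:
  assumes two: "(2::'k) \<noteq> 0" and "filiform"
    and deep: "\<And>x v. v \<in> lower_central 1 \<Longrightarrow> x \<cdot> v \<in> lower_central 3"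
    and "v \<in> lower_central 2"
  shows "x \<cdot> v = 0"
proof -
  have lc21: "lower_central 2 \<subseteq> lower_central 1"
    by (rule lower_central_antimono) simp
  \<comment> \<open>The depth is raised without bound; nilpotency then gives 0.\<close>
  have *: "x \<cdot> v \<in> lower_central (Suc m)" if "v \<in> lower_central 2" for m x v
    using that
  proof (induction m arbitrary: x v)
    case 0
    then show ?case using mult_lower_central lc21 by (metis One_nat_def subsetD)
  next
    case (Suc m)
    \<comment> \<open>The bracket becomes an outer product, which gains one level over the induction
      hypothesis.\<close>
    have inner: "y \<cdot> u \<in> lower_central (Suc (Suc m))" if "u \<in> lower_central (Suc 2)" for y u
      using that
    proof (induction rule: lower_central_induct)
      case subspace
      show ?case by (intro subspace_mult_vimage subspace_lower_central)
    next
      case (bracket y' w)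
      then have "y \<cdot> bracket y' w = y' \<cdot> (y \<cdot> w)"
        using mult_bracket_lower_central_1 [OF two] lc21 by blast
      then show ?case
        using mult_lower_central_Suc [OF two \<open>filiform\<close> _ Suc.IH [OF bracket]] by simp
    qed
    from Suc.prems have "v \<in> lower_central (Suc 1)" by (simp add: numeral_2_eq_2)
    then show ?case
    proof (induction rule: lower_central_induct)
      case subspace
      show ?case by (intro subspace_mult_vimage subspace_lower_central)
    next
      case (bracket y w)
      \<comment> \<open>The product equals \<open>y \<cdot> (x \<cdot> w)\<close>, and
        \<open>deep\<close> makes \<open>x \<cdot> w\<close> fit \<open>inner\<close>.\<close>
      then show ?case
        using mult_bracket_lower_central_1 [OF two bracket] inner deep [OF bracket]
        by (simp add: eval_nat_numeral)
    qed
  qed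
  obtain N where "lower_central N = {0}"
    using \<open>filiform\<close> unfolding filiform_def nilpotent_def by blast
  then show ?thesis
    using * [OF assms(4), of x N] lower_central_Suc_subset [of N] by auto
qed

section \<open>Vanishing of products with commutators\<close>

theorem filiform_mult_lower_central_1:
  assumes two: "(2::'k) \<noteq> 0" and fil: "filiform" and solv: "\<not> solvability_class \<le> 2"
    and "v \<in> lower_central 1"
  shows "x \<cdot> v = 0"
proof (cases "\<forall>a b. a \<cdot> b \<in> lower_central 2")
  case True
  have "x \<cdot> v \<in> lower_central 3" if "v \<in> lower_central (Suc 0)" for x v
    using that
  proof (induction rule: lower_central_induct)
    case subspace
    show ?case by (intro subspace_mult_vimage subspace_lower_central)
  next
    case (bracket y z)
    show ?case
      unfolding mult_bracket using True bracket_lower_central [of _ 2]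
      by (auto simp: numeral_3_eq_3 numeral_2_eq_2 intro: subspace_add [OF subspace_lower_central])
  qed
  then have zero: "x \<cdot> v = 0" if "v \<in> lower_central 2" for x v
    using mult_lower_central_2_eq_0 [OF two fil] that by simp
  from assms(4) have "v \<in> lower_central (Suc 0)" by simp
  then show ?thesis
  proof (induction rule: lower_central_induct)
    case subspace
    show ?case using subspace_mult_vimage [of "{0}" x] by simp
  next
    case (bracket y z)
    \<comment> \<open>In \<open>y \<cdot> (z \<cdot> x) - z \<cdot> (y \<cdot> x)\<close> the inner
      products lie in \<open>lower_central 2\<close>, so \<open>zero\<close> applies.\<close>
    show ?case
      by (subst commute, subst bracket_mult) (simp add: zero True)
  qed
next
  case False
  then obtain a b where ab: "a \<cdot> b \<notin> lower_central 2" by blast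
  \<comment> \<open>Both say that \<open>lower_central 1\<close> and \<open>lower_central 2\<close>
    do not commute, once for each centralizer used below.\<close>
  have nonzero: "\<not> lower_central 2 \<subseteq> {x. \<forall>y\<in>lower_central 1. bracket x y = 0}"
    "\<not> lower_central 1 \<subseteq> {x. \<forall>y\<in>lower_central 2. bracket x y = 0}"
  proof -
    show "\<not> lower_central 1 \<subseteq> {x. \<forall>y\<in>lower_central 2. bracket x y = 0}"
      using solvability_class_le_2 [OF fil] solv by blast
    then show "\<not> lower_central 2 \<subseteq> {x. \<forall>y\<in>lower_central 1. bracket x y = 0}"
      using bracket_swap by (smt (verit) mem_Collect_eq neg_equal_0_iff_equal subset_iff)
  qed
  have ideals: "lie_ideal {x. \<forall>y\<in>lower_central k. bracket x y = 0}" for k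
    using bracket_lower_central(1) lower_central_Suc_subset
    by (intro lie_ideal_centralizer) blast
  have "lie_ideal {z. \<forall>w\<in>lower_central 1. z \<cdot> w = 0}"
    unfolding lie_ideal_def using mult_lower_central [of _ 1]
    by (auto simp: subspace_def product.mult_linear_simps bracket_mult)
  moreover have "a \<cdot> b \<in> {z. \<forall>w\<in>lower_central 1. z \<cdot> w = 0}"
    by (simp add: commute [of "a \<cdot> b"] commutator_mult_mult [OF two])
  ultimately have "lower_central 1 \<subseteq> {z. \<forall>w\<in>lower_central 1. z \<cdot> w = 0}"
    using ab by (intro lower_central_subset_lie_ideal [OF fil]) (auto simp: numeral_2_eq_2)
  \<comment> \<open>Both terms of \<open>bracket_mult_lower_central_1\<close> contain
    \<open>v \<cdot> y = 0\<close>.\<close>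
  then have "bracket (x \<cdot> v) y = 0" if "v \<in> lower_central 1" "y \<in> lower_central 1" for x v y
    using that by (auto simp: bracket_mult_lower_central_1 [OF two]
        product.mult_linear_simps mult_linear_simps)
  moreover have "{x. \<forall>y\<in>lower_central 1. bracket x y = 0} \<subseteq> lower_central (Suc 2)"
    using lower_central_subset_lie_ideal [OF fil ideals, of 2] nonzero(1) by fastforce
  ultimately have "x \<cdot> v \<in> lower_central 3" if "v \<in> lower_central 1" for x v
    using that by (auto simp: numeral_3_eq_3 numeral_2_eq_2)
  then have zero: "x \<cdot> v = 0" if "v \<in> lower_central 2" for x v
    using mult_lower_central_2_eq_0 [OF two fil] that by blast
  have "lower_central 2 \<subseteq> lower_central 1"
    by (rule lower_central_antimono) simp
  then have "bracket (a \<cdot> b) y = 0" if "y \<in> lower_central 2" for y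
    using that bracket_mult_lower_central_1 [OF two, of y a b]
    by (auto simp: zero product.mult_linear_simps mult_linear_simps)
  \<comment> \<open>The element \<open>a \<cdot> b\<close> witnesses this. The centralizer thus
    contains \<open>lower_central 1\<close>, contradicting \<open>nonzero\<close>, so this case
    cannot occur.\<close>
  then have "\<not> {x. \<forall>y\<in>lower_central 2. bracket x y = 0} \<subseteq> lower_central (Suc 1)"
    using ab by (auto simp: numeral_2_eq_2)
  then show ?thesis
    using lower_central_subset_lie_ideal [OF fil ideals, of 1 2] nonzero(2) by blast
qed

section \<open>Associativity and Poisson-admissibility\<close>

lemma associative_iff: "associative \<longleftrightarrow> (\<forall>x. \<forall>v\<in>lower_central 1. x \<cdot> v = 0)"
  unfolding associative_def product.prod_span_eq_zero_iff One_nat_def lower_central.simps by blast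

text \<open>Since \<open>bracket x z \<cdot> y = 0\<close>, multiplications by \<open>x\<close> and
  \<open>z\<close> commute, which for a commutative product is associativity.\<close>

lemma associative_mult_assoc:
  assumes "associative"
  shows "(x \<cdot> y) \<cdot> z = x \<cdot> (y \<cdot> z)"
proof -
  have "bracket x z \<in> lower_central 1"
    using bracket_lower_central(1) [of z 0 x] by (simp add: lower_central.simps(1))
  then have "y \<cdot> bracket x z = 0"
    using assms unfolding associative_iff by blast
  then have "x \<cdot> (z \<cdot> y) = z \<cdot> (x \<cdot> y)"
    using bracket_mult [of x z y] commute [of "bracket x z" y] by simp
  then show ?thesis by (simp add: commute [of z])
qed

end

text \<open>Symmetrizing a commutative product returns it, and its commutator is zero, so the
  Leibniz rule is trivial.\<close>

lemma poisson_admissible_if_associative: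
  fixes scale :: "'k::field_char_0 \<Rightarrow> 'v::ab_group_add \<Rightarrow> 'v"
  assumes "cpa_structure scale bracket mult" and "cpa_structure.associative scale bracket mult"
  shows "poisson_admissible scale mult"
proof -
  interpret cpa_structure scale bracket mult by (rule assms)
  have circ: "(\<lambda>x y. scale (1 / 2) (mult x y + mult y x)) = mult"
  proof (intro ext)
    fix x y
    have "scale (1 / 2) (mult x y + mult y x) = scale (1 / 2 + 1 / 2) (mult x y)"
      by (simp only: commute [of y x] scale_left_distrib scale_right_distrib)
    then show "scale (1 / 2) (mult x y + mult y x) = mult x y" by simp
  qed
  have brk: "(\<lambda>x y. mult x y - mult y x) = (\<lambda>x y. 0)"
    using commute by (simp add: fun_eq_iff)
  interpret zero_bracket: lie_algebra scale "\<lambda>x y. 0"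
    by unfold_locales simp_all
  have "poisson_algebra scale mult (\<lambda>x y. 0)"
  proof unfold_locales
    show "mult x y = mult y x" for x y by (rule commute)
    show "mult (mult x y) z = mult x (mult y z)" for x y z
      by (rule associative_mult_assoc [OF assms(2)])
  qed (simp_all add: product.mult_linear_simps)
  then show ?thesis
    unfolding poisson_admissible_def circ brk using product.nonassoc_algebra_axioms by simp
qed

theorem theorem3p4:
  fixes scale :: "complex \<Rightarrow> 'v::ab_group_add \<Rightarrow> 'v"
    and bracket mult :: "'v \<Rightarrow> 'v \<Rightarrow> 'v"
  assumes "lie_algebra scale bracket"
    and "lie_algebra.filiform scale bracket"
    and "lie_algebra.solvability_class scale bracket \<ge> 3"
    and "cpa_structure scale bracket mult"
  shows "cpa_structure.associative scale bracket mult \<and> poisson_admissible scale mult"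
proof -
  interpret cpa_structure scale bracket mult by (rule assms)
  have "associative"
    using assms(2,3) unfolding associative_iff by (auto intro: filiform_mult_lower_central_1)
  then show ?thesis
    using poisson_admissible_if_associative [OF assms(4)] by simp
qed

end
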